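(* The perfect classification fan is not always strongly connected: there exist $d,n,m\ge1$, a finite data set $\mathcal D\subset\mathbb R^d$ and a target dichotomy $C^*\in\{+,-\}^{|\mathcal D|}$ such that the perfect classification fan $\Sigma^0_{\mathcal D}(n,m)$ is not strongly connected.
   Context: $\Theta(d,n,m)\cong\mathbb R^{(n+m)(d+1)}$ is the space of parameters $\theta=(a_1,\mathbf s_1,\dots,a_n,\mathbf s_n,b_1,\mathbf t_1,\dots,b_m,\mathbf t_m)$; put $a_{n+j}=b_j$, $\mathbf s_{n+j}=\mathbf t_j$ for $j\in[m]$, so $[n+m]=[n]\sqcup[m]$. The activation pattern of $\theta$ is the bipartite graph on $\mathcal D\sqcup([n]\sqcup[m])$ in which $\mathbf p$ is joined to exactly those indices $l$ with $a_l+\langle\mathbf s_l,\mathbf p\rangle=\max_{l'\in[n]\sqcup[m]}(a_{l'}+\langle\mathbf s_{l'},\mathbf p\rangle)$. The activation cone of a graph $G$ is the Euclidean closure of the set of $\theta$ with activation pattern $G$; the classification fan $\Sigma_{\mathcal D}(n,m)$ is the set of all (nonempty) activation cones, a complete polyhedral fan in $\Theta(d,n,m)$. $N(\mathbf p;G)$ is the set of neighbors of $\mathbf p$ in $G$. Write $\mathcal D=\{\mathbf p_1,\dots,\mathbf p_M\}$, $\mathcal D_+=\{\mathbf p_i\mid C^*_i=+\}$, $\mathcal D_-=\mathcal D\setminus\mathcal D_+$. An activation pattern $G$ is weakly compatible with $C^*$ if $N(\mathbf p;G)\cap[n]\ne\emptyset$ for all $\mathbf p\in\mathcal D_+$ and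 $N(\mathbf p;G)\cap[m]\neq\emptyset$ for all $\mathbf p\in\mathcal D_-$. The perfect classification fan $\Sigma^0_{\mathcal D}(n,m)$ is the subfan of $\Sigma_{\mathcal D}(n,m)$ consisting of the cones whose activation patterns are weakly compatible with $C^*$. The fan is strongly connected if for all full-dimensional cones $C,D$ in it there is a sequence of full-dimensional cones $C=C_0,C_1,\dots,C_{k+1}=D$ in it such that each $C_i\cap C_{i+1}$ has codimension $1$ in $\Theta(d,n,m)$. *)

theory Defs
  imports "HOL-Analysis.Analysis" "HOL-Library.Function_Algebras"
begin

text \<open>
  \<open>\<real>\<^sup>N\<close> is the library's \<^const>\<open>Euclidean_space\<close> \<open>N\<close>, i.e. the sequences vanishing from
  index \<open>N\<close> on, so that \<open>d\<close>, \<open>n\<close> and \<open>m\<close> can be quantified inside a statement.  The pointwise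
  real vector space structure below makes the library's \<^const>\<open>dim\<close> (dimension of the linear
  span) available for subsets of these spaces.
\<close>

instantiation "fun" :: (type, real_vector) real_vector
begin

definition scaleR_fun :: "real \<Rightarrow> ('a \<Rightarrow> 'b) \<Rightarrow> 'a \<Rightarrow> 'b" where
  "scaleR_fun c f = (\<lambda>x. c *\<^sub>R f x)"

instance
  by standard (simp_all add: scaleR_fun_def fun_eq_iff scaleR_add_right scaleR_add_left)

end

text \<open>All indices are 0-based: \<open>[n]\<close> is \<open>{..<n}\<close>, and \<open>[n] \<squnion> [m]\<close> is \<open>{..<n + m}\<close>, whose second
  summand \<open>[m]\<close> is \<open>{n..<n + m}\<close>.\<close>

definition param_dim :: "nat \<Rightarrow> nat \<Rightarrow> nat \<Rightarrow> nat" where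
  "param_dim d n m = (n + m) * (d + 1)"

definition param_space :: "nat \<Rightarrow> nat \<Rightarrow> nat \<Rightarrow> (nat \<Rightarrow> real) topology" where
  "param_space d n m = Euclidean_space (param_dim d n m)"

text \<open>A parameter \<open>\<theta> = (a\<^sub>0, s\<^sub>0, a\<^sub>1, s\<^sub>1, \<dots>)\<close> consists of \<open>n + m\<close> consecutive blocks of length
  \<open>d + 1\<close>, block \<open>l\<close> being the bias \<open>a\<^sub>l\<close> followed by the \<open>d\<close> coordinates of the slope \<open>s\<^sub>l\<close>.\<close>

definition bias :: "nat \<Rightarrow> (nat \<Rightarrow> real) \<Rightarrow> nat \<Rightarrow> real" where
  "bias d \<theta> l = \<theta> (l * (d + 1))"

definition slope :: "nat \<Rightarrow> (nat \<Rightarrow> real) \<Rightarrow> nat \<Rightarrow> nat \<Rightarrow> real" where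
  "slope d \<theta> l k = \<theta> (l * (d + 1) + 1 + k)"

definition affine_value :: "nat \<Rightarrow> (nat \<Rightarrow> real) \<Rightarrow> nat \<Rightarrow> (nat \<Rightarrow> real) \<Rightarrow> real" where
  "affine_value d \<theta> l p = bias d \<theta> l + (\<Sum>k<d. slope d \<theta> l k * p k)"

text \<open>A bipartite graph on \<open>\<D> \<squnion> ([n] \<squnion> [m])\<close> is given by its edges \<open>(p, l)\<close>.\<close>

type_synonym bipartite_graph = "((nat \<Rightarrow> real) \<times> nat) set"

definition neighbors :: "(nat \<Rightarrow> real) \<Rightarrow> bipartite_graph \<Rightarrow> nat set" where
  "neighbors p G = {l. (p, l) \<in> G}"

definition activation_pattern ::
  "nat \<Rightarrow> nat \<Rightarrow> nat \<Rightarrow> (nat \<Rightarrow> real) set \<Rightarrow> (nat \<Rightarrow> real) \<Rightarrow> bipartite_graph" where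
  "activation_pattern d n m \<D> \<theta> =
     {(p, l). p \<in> \<D> \<and> l < n + m \<and>
        affine_value d \<theta> l p = Max ((\<lambda>l'. affine_value d \<theta> l' p) ` {..<n + m})}"

definition is_activation_pattern ::
  "nat \<Rightarrow> nat \<Rightarrow> nat \<Rightarrow> (nat \<Rightarrow> real) set \<Rightarrow> bipartite_graph \<Rightarrow> bool" where
  "is_activation_pattern d n m \<D> G \<longleftrightarrow>
     (\<exists>\<theta> \<in> topspace (param_space d n m). activation_pattern d n m \<D> \<theta> = G)"

definition activation_cone ::
  "nat \<Rightarrow> nat \<Rightarrow> nat \<Rightarrow> (nat \<Rightarrow> real) set \<Rightarrow> bipartite_graph \<Rightarrow> (nat \<Rightarrow> real) set" where
  "activation_cone d n m \<D> G =
     param_space d n m closure_of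
       {\<theta> \<in> topspace (param_space d n m). activation_pattern d n m \<D> \<theta> = G}"

definition classification_fan ::
  "nat \<Rightarrow> nat \<Rightarrow> nat \<Rightarrow> (nat \<Rightarrow> real) set \<Rightarrow> (nat \<Rightarrow> real) set set" where
  "classification_fan d n m \<D> =
     {activation_cone d n m \<D> G | G. is_activation_pattern d n m \<D> G}"

datatype sign = Plus | Minus

text \<open>A target dichotomy assigns a sign to each data point; only its values on \<open>\<D>\<close> matter.\<close>

definition weakly_compatible ::
  "nat \<Rightarrow> nat \<Rightarrow> (nat \<Rightarrow> real) set \<Rightarrow> ((nat \<Rightarrow> real) \<Rightarrow> sign) \<Rightarrow> bipartite_graph \<Rightarrow> bool" where
  "weakly_compatible n m \<D> C G \<longleftrightarrow>
     (\<forall>p \<in> {p \<in> \<D>. C p = Plus}. neighbors p G \<inter> {..<n} \<noteq> {}) \<and>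
     (\<forall>p \<in> \<D> - {p \<in> \<D>. C p = Plus}. neighbors p G \<inter> {n..<n + m} \<noteq> {})"

definition perfect_classification_fan ::
  "nat \<Rightarrow> nat \<Rightarrow> nat \<Rightarrow> (nat \<Rightarrow> real) set \<Rightarrow> ((nat \<Rightarrow> real) \<Rightarrow> sign)
    \<Rightarrow> (nat \<Rightarrow> real) set set" where
  "perfect_classification_fan d n m \<D> C =
     {K \<in> classification_fan d n m \<D>.
        \<exists>G. is_activation_pattern d n m \<D> G \<and> weakly_compatible n m \<D> C G \<and>
          K = activation_cone d n m \<D> G}"

text \<open>A cone \<open>K\<close> contains the origin, so its dimension is that of its linear span, \<open>dim K\<close>.\<close>

definition full_dim_cones :: "nat \<Rightarrow> (nat \<Rightarrow> real) set set \<Rightarrow> (nat \<Rightarrow> real) set set" where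
  "full_dim_cones N F = {K \<in> F. dim K = N}"

text \<open>Strong connectivity of a fan in \<open>\<real>\<^sup>N\<close>.  The chain \<open>S 0, \<dots>, S r\<close> may have \<open>r = 0\<close>, so that
  a fan with a single full-dimensional cone is strongly connected.\<close>

definition strongly_connected_fan :: "nat \<Rightarrow> (nat \<Rightarrow> real) set set \<Rightarrow> bool" where
  "strongly_connected_fan N F \<longleftrightarrow>
     (\<forall>K \<in> full_dim_cones N F. \<forall>L \<in> full_dim_cones N F.
        \<exists>r (S :: nat \<Rightarrow> (nat \<Rightarrow> real) set).
          S 0 = K \<and> S r = L \<and> (\<forall>i\<le>r. S i \<in> full_dim_cones N F) \<and>
          (\<forall>i<r. dim (S i \<inter> S (Suc i)) + 1 = N))"

end

theory Submission
  imports Defs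
begin

text \<open>
  The counterexample consists of the points \<open>-1, 0, 1\<close> on the real line with signs \<open>+, -, +\<close>,
  together with \<open>n = 2\<close> positive and \<open>m = 1\<close> negative affine functions \<open>v\<^sub>0, v\<^sub>1\<close> and \<open>v\<^sub>2\<close>.

  In a weakly compatible pattern some positive index \<open>i\<close> is maximal at \<open>-1\<close>, some positive index
  \<open>j\<close> is maximal at \<open>1\<close>, and \<open>2\<close> is maximal at \<open>0\<close>.  So each cone of the fan lies in one of the
  four closed sets \<open>region i j\<close> given by these non-strict conditions
  (\<open>perfect_cone_subset_region\<close>).  The obstruction to connectivity is convexity of the upper
  envelope: if one affine function \<open>v\<^sub>i\<close> dominates \<open>v\<^sub>2\<close> at both \<open>-1\<close> and \<open>1\<close> but does not
  exceed it at \<open>0\<close>, then \<open>v\<^sub>i = v\<^sub>2\<close> (\<open>affine_rigidity\<close>).  Hence \<open>region 0 0\<close> and \<open>region 1 1\<close>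
  lie in subspaces of codimension two and contain no full-dimensional cone.  On
  \<open>region 0 1 \<inter> region 1 0\<close> the functions \<open>v\<^sub>0\<close> and \<open>v\<^sub>1\<close> agree at \<open>-1\<close> and at \<open>1\<close>, so this
  intersection has codimension at least two as well (\<open>region_Int_subset\<close>).

  Both \<open>region 0 1\<close> and \<open>region 1 0\<close> do contain a full-dimensional cone: the upper envelope
  of \<open>-2x\<close>, \<open>2x\<close> and \<open>1\<close> realises the required strict pattern, with either of the two slopes
  assigned to \<open>v\<^sub>0\<close>, and small perturbations of the parameters keep it.  A chain from one of these
  cones to the other would have to step from \<open>region 0 1\<close> into \<open>region 1 0\<close>, and there two
  consecutive cones would meet in codimension at least two.
\<close>

section \<open>Dimension of sets of real sequences\<close>

definition unit_vec :: "nat \<Rightarrow> nat \<Rightarrow> real" where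
  "unit_vec k = (\<lambda>i. if i = k then 1 else 0)"

lemma sum_fun_apply: "(\<Sum>a\<in>A. f a) x = (\<Sum>a\<in>A. f a x)"
  for f :: "'a \<Rightarrow> 'b \<Rightarrow> 'c::comm_monoid_add"
  by (induction A rule: infinite_finite_induct) auto

lemma scaleR_fun_apply: "(c *\<^sub>R f) x = c *\<^sub>R f x" for f :: "'a \<Rightarrow> 'b::real_vector"
  by (simp add: scaleR_fun_def)

lemma inj_unit_vec: "inj_on unit_vec A"
proof (rule inj_onI)
  fix k l assume "unit_vec k = unit_vec l"
  then have "unit_vec k k = unit_vec l k"
    by simp
  then show "k = l"
    by (simp add: unit_vec_def split: if_splits)
qed

lemma independent_unit_vec: "independent (unit_vec ` {..<N})"
proof (rule independent_if_scalars_zero)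
  fix f x
  assume zero: "(\<Sum>v\<in>unit_vec ` {..<N}. f v *\<^sub>R v) = 0" and "x \<in> unit_vec ` {..<N}"
  then obtain k where k: "k < N" "x = unit_vec k"
    by auto
  have "(\<Sum>v\<in>unit_vec ` {..<N}. f v *\<^sub>R v) k = (\<Sum>i<N. (f (unit_vec i) *\<^sub>R unit_vec i) k)"
    by (simp add: sum.reindex[OF inj_unit_vec] sum_fun_apply)
  also have "\<dots> = (\<Sum>i<N. if i = k then f (unit_vec i) else 0)"
    by (rule sum.cong) (auto simp: scaleR_fun_apply unit_vec_def)
  finally show "f x = 0"
    using zero k by simp
qed simp

lemma Euclidean_space_subset_span:
  "topspace (Euclidean_space N) \<subseteq> span (unit_vec ` {..<N})"
proof
  fix x assume x: "x \<in> topspace (Euclidean_space N)"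
  have "x = (\<Sum>k<N. x k *\<^sub>R unit_vec k)"
  proof
    fix i
    have "(\<Sum>k<N. x k *\<^sub>R unit_vec k) i = (\<Sum>k<N. if i = k then x k else 0)"
      unfolding sum_fun_apply by (rule sum.cong) (auto simp: scaleR_fun_apply unit_vec_def)
    then show "x i = (\<Sum>k<N. x k *\<^sub>R unit_vec k) i"
      using x by (auto simp: topspace_Euclidean_space)
  qed
  also have "\<dots> \<in> span (unit_vec ` {..<N})"
    by (intro span_sum span_scale span_base) auto
  finally show "x \<in> span (unit_vec ` {..<N})" .
qed

text \<open>The differences between the perturbed points and \<open>x\<close> are multiples of the unit vectors.\<close>

lemma dim_eq_if_coordinate_perturbations:
  assumes A: "A \<subseteq> topspace (Euclidean_space N)" and x: "x \<in> A" and c: "c \<noteq> 0"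
    and perturbed: "\<And>k. k < N \<Longrightarrow> x + c *\<^sub>R unit_vec k \<in> A"
  shows "dim A = N"
proof -
  have "unit_vec k \<in> span A" if "k < N" for k
  proof -
    have "(1 / c) *\<^sub>R ((x + c *\<^sub>R unit_vec k) - x) \<in> span A"
      by (intro span_scale span_diff span_base x perturbed that)
    then show ?thesis
      using c by simp
  qed
  moreover have "span A \<subseteq> span (unit_vec ` {..<N})"
    using A Euclidean_space_subset_span by (meson order_trans span_minimal subspace_span)
  ultimately have "dim (span A) = N"
    by (intro dim_unique[of "unit_vec ` {..<N}"] independent_unit_vec)
      (auto simp: card_image[OF inj_unit_vec])
  then show ?thesis
    by simp
qed

text \<open>Merging the \<open>a\<close>-th with the \<open>b\<close>-th and the \<open>c\<close>-th with the \<open>e\<close>-th unit vector leaves a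
  spanning set of \<open>N - 2\<close> vectors.\<close>

lemma dim_le_if_two_coordinate_pairs_equal:
  assumes A: "A \<subseteq> topspace (Euclidean_space N)"
    and eq: "\<And>x. x \<in> A \<Longrightarrow> x a = x b \<and> x c = x e"
    and "distinct [a, b, c, e]" "b < N" "e < N" "a < N" "c < N"
  shows "dim A + 2 \<le> N"
proof -
  define w where "w k = unit_vec k + (if k = a then unit_vec b else 0)
    + (if k = c then unit_vec e else 0)" for k
  let ?I = "{..<N} - {b, e}"
  have "A \<subseteq> span (w ` ?I)"
  proof
    fix x assume x: "x \<in> A"
    have "x = (\<Sum>k\<in>?I. x k *\<^sub>R w k)"
    proof
      fix i
      have "(\<Sum>k\<in>?I. x k *\<^sub>R w k) i = (\<Sum>k\<in>?I. (if k = i then x k else 0)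
          + (if k = a then (if i = b then x k else 0) else 0)
          + (if k = c then (if i = e then x k else 0) else 0))"
        unfolding sum_fun_apply
        by (rule sum.cong) (auto simp: scaleR_fun_apply w_def unit_vec_def)
      also have "\<dots> = (if i \<in> ?I then x i else 0) + (if i = b then x a else 0)
          + (if i = e then x c else 0)"
        using assms(3-) by (simp add: sum.distrib)
      also have "\<dots> = x i"
        using assms(3-) eq[OF x] x A by (auto simp: topspace_Euclidean_space)
      finally show "x i = (\<Sum>k\<in>?I. x k *\<^sub>R w k) i" ..
    qed
    also have "\<dots> \<in> span (w ` ?I)"
      by (intro span_sum span_scale span_base) auto
    finally show "x \<in> span (w ` ?I)" .
  qed
  then have "dim A \<le> card (w ` ?I)"
    by (intro dim_le_card) auto
  also have "\<dots> \<le> card ?I"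
    by (intro card_image_le) auto
  also have "\<dots> = N - 2"
    using assms(3-) by (simp add: card_Diff_subset)
  finally have "dim A \<le> N - 2" .
  moreover have "2 \<le> N"
    using assms(3-) by auto
  ultimately show ?thesis
    by simp
qed

section \<open>Activation patterns and cones\<close>

lemma activation_pattern_iff:
  "(p, l) \<in> activation_pattern d n m \<D> \<theta> \<longleftrightarrow>
     p \<in> \<D> \<and> l < n + m \<and> (\<forall>l'<n + m. affine_value d \<theta> l' p \<le> affine_value d \<theta> l p)"
proof -
  have "affine_value d \<theta> l p = Max ((\<lambda>l'. affine_value d \<theta> l' p) ` {..<n + m}) \<longleftrightarrow>
      (\<forall>l'<n + m. affine_value d \<theta> l' p \<le> affine_value d \<theta> l p)" if "l < n + m"
    using that by (subst eq_Max_iff) auto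
  then show ?thesis
    by (auto simp: activation_pattern_def)
qed

lemma activation_cone_subset:
  assumes "closedin (param_space d n m) S"
    and "\<And>\<theta>. \<theta> \<in> topspace (param_space d n m) \<Longrightarrow> activation_pattern d n m \<D> \<theta> = G \<Longrightarrow> \<theta> \<in> S"
  shows "activation_cone d n m \<D> G \<subseteq> S"
  unfolding activation_cone_def by (rule closure_of_minimal) (use assms in auto)

lemma activation_cone_subset_topspace:
  "activation_cone d n m \<D> G \<subseteq> topspace (param_space d n m)"
  unfolding activation_cone_def by (rule closure_of_subset_topspace)

lemma in_activation_cone:
  assumes "\<theta> \<in> topspace (param_space d n m)" "activation_pattern d n m \<D> \<theta> = G"
  shows "\<theta> \<in> activation_cone d n m \<D> G"
  unfolding activation_cone_def
  by (rule subsetD[OF closure_of_subset]) (use assms in auto)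

lemma continuous_on_affine_value: "continuous_on UNIV (\<lambda>\<theta>. affine_value d \<theta> l p)"
  unfolding affine_value_def bias_def slope_def
  by (intro continuous_on_add continuous_on_sum continuous_on_mult continuous_on_const
      continuous_on_product_coordinates)

lemma closedin_param_space:
  assumes "closed S"
  shows "closedin (param_space d n m) (topspace (param_space d n m) \<inter> S)"
proof -
  have "closedin (subtopology euclidean {x. \<forall>i\<ge>param_dim d n m. x i = 0})
      ({x. \<forall>i\<ge>param_dim d n m. x i = 0} \<inter> S)"
    unfolding closedin_subtopology
    by (intro exI[of _ S] conjI) (use assms in \<open>simp_all add: Int_commute\<close>)
  then show ?thesis
    unfolding param_space_def topspace_Euclidean_space
    by (simp add: Euclidean_space_def euclidean_product_topology)
qed

section \<open>Three points on the line with signs plus, minus, plus\<close>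

definition point :: "real \<Rightarrow> nat \<Rightarrow> real" where
  "point x = (\<lambda>k. if k = 0 then x else 0)"

definition points :: "(nat \<Rightarrow> real) set" where
  "points = {point (-1), point 0, point 1}"

definition dichotomy :: "(nat \<Rightarrow> real) \<Rightarrow> sign" where
  "dichotomy p = (if p 0 = 0 then Minus else Plus)"

definition val :: "(nat \<Rightarrow> real) \<Rightarrow> nat \<Rightarrow> real \<Rightarrow> real" where
  "val \<theta> l x = \<theta> (2 * l) + \<theta> (2 * l + 1) * x"

lemma point_apply_0: "point x 0 = x"
  by (simp add: point_def)

lemma affine_value_point: "affine_value 1 \<theta> l (point x) = val \<theta> l x"
proof -
  have block: "l * (1 + 1) = 2 * l"
    by simp
  show ?thesis
    unfolding affine_value_def bias_def slope_def val_def block by (simp add: point_apply_0)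
qed

lemma point_eq_iff [simp]: "point x = point y \<longleftrightarrow> x = y"
  by (auto dest: arg_cong[where f = "\<lambda>p. p 0"] simp: point_apply_0)

abbreviation space6 :: "(nat \<Rightarrow> real) set" where
  "space6 \<equiv> topspace (param_space 1 2 1)"

definition region :: "nat \<Rightarrow> nat \<Rightarrow> (nat \<Rightarrow> real) set" where
  "region i j = {\<theta> \<in> space6. \<forall>l<3. val \<theta> l (-1) \<le> val \<theta> i (-1) \<and> val \<theta> l 0 \<le> val \<theta> 2 0
     \<and> val \<theta> l 1 \<le> val \<theta> j 1}"

definition coincidence :: "nat \<Rightarrow> nat \<Rightarrow> (nat \<Rightarrow> real) set" where
  "coincidence a b = {\<theta> \<in> space6. \<theta> (2 * a) = \<theta> (2 * b) \<and> \<theta> (2 * a + 1) = \<theta> (2 * b + 1)}"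

lemma closedin_region: "closedin (param_space 1 2 1) (region i j)"
proof -
  let ?S = "\<Inter>l\<in>{..<3}. {\<theta>. val \<theta> l (-1) \<le> val \<theta> i (-1)} \<inter> {\<theta>. val \<theta> l 0 \<le> val \<theta> 2 0}
    \<inter> {\<theta>. val \<theta> l 1 \<le> val \<theta> j 1}"
  have "closed ?S"
    unfolding affine_value_point[symmetric]
    by (intro closed_INT ballI closed_Int closed_Collect_le continuous_on_affine_value)
  moreover have "region i j = space6 \<inter> ?S"
    by (auto simp: region_def)
  ultimately show ?thesis
    by (simp only: closedin_param_space)
qed

lemma dim_coincidence:
  assumes "A \<subseteq> coincidence a b" "a \<noteq> b" "a < 3" "b < 3"
  shows "dim A \<le> 4"
proof -
  have "dim A + 2 \<le> 6"
  proof (rule dim_le_if_two_coordinate_pairs_equal)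
    show "A \<subseteq> topspace (Euclidean_space 6)"
      using assms(1) by (auto simp: coincidence_def param_space_def param_dim_def)
    show "x (2 * a) = x (2 * b) \<and> x (2 * a + 1) = x (2 * b + 1)" if "x \<in> A" for x
      using assms(1) that by (auto simp: coincidence_def)
    show "distinct [2 * a, 2 * b, 2 * a + 1, 2 * b + 1]"
      using assms(2) by (auto; presburger)
  qed (use assms(3,4) in auto)
  then show ?thesis
    by simp
qed

text \<open>The difference of the two functions is nonnegative at \<open>-1\<close> and \<open>1\<close> and nonpositive at
  the midpoint, where its value is the mean of the other two; so all three vanish.\<close>

lemma affine_rigidity:
  assumes "val \<theta> b (-1) \<le> val \<theta> a (-1)" "val \<theta> a 0 \<le> val \<theta> b 0" "val \<theta> b 1 \<le> val \<theta> a 1"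
  shows "\<theta> (2 * a) = \<theta> (2 * b) \<and> \<theta> (2 * a + 1) = \<theta> (2 * b + 1)"
proof -
  have "\<theta> (2 * b) - \<theta> (2 * b + 1) \<le> \<theta> (2 * a) - \<theta> (2 * a + 1)" "\<theta> (2 * a) \<le> \<theta> (2 * b)"
    "\<theta> (2 * b) + \<theta> (2 * b + 1) \<le> \<theta> (2 * a) + \<theta> (2 * a + 1)"
    using assms by (simp_all only: val_def mult_1_right mult_minus1_right mult_zero_right
        add_0_right diff_conv_add_uminus)
  then show ?thesis
    by linarith
qed

lemma region_diagonal_subset:
  assumes "i < 3"
  shows "region i i \<subseteq> coincidence i 2"
proof
  fix \<theta> assume "\<theta> \<in> region i i"
  then have "\<theta> \<in> space6" "val \<theta> 2 (-1) \<le> val \<theta> i (-1)" "val \<theta> i 0 \<le> val \<theta> 2 0"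
    "val \<theta> 2 1 \<le> val \<theta> i 1"
    using assms unfolding region_def by simp_all
  then show "\<theta> \<in> coincidence i 2"
    unfolding coincidence_def using affine_rigidity by blast
qed

text \<open>Both indices \<open>0\<close> and \<open>1\<close> are maximal at \<open>-1\<close> and at \<open>1\<close>, and an affine function is
  determined by two values.\<close>

lemma region_Int_subset: "region 0 1 \<inter> region 1 0 \<subseteq> coincidence 0 1"
proof
  fix \<theta> assume \<theta>: "\<theta> \<in> region 0 1 \<inter> region 1 0"
  have "val \<theta> l (-1) \<le> val \<theta> 0 (-1)" "val \<theta> l (-1) \<le> val \<theta> 1 (-1)"
    "val \<theta> l 1 \<le> val \<theta> 0 1" "val \<theta> l 1 \<le> val \<theta> 1 1" if "l < 3" for l
    using \<theta> that unfolding region_def by blast+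
  from this[of 0] this[of 1] have "val \<theta> 0 (-1) = val \<theta> 1 (-1)" "val \<theta> 0 1 = val \<theta> 1 1"
    by (simp_all add: antisym)
  then show "\<theta> \<in> coincidence 0 1"
    using \<theta> by (simp add: val_def coincidence_def region_def)
qed

lemma activation_pattern_points_iff:
  "(point x, l) \<in> activation_pattern 1 2 1 points \<theta> \<longleftrightarrow>
     point x \<in> points \<and> l < 3 \<and> (\<forall>l'<3. val \<theta> l' x \<le> val \<theta> l x)"
proof -
  have "2 + 1 = (3::nat)"
    by simp
  then show ?thesis
    by (simp only: activation_pattern_iff affine_value_point)
qed

lemma activation_cone_subset_region:
  assumes "(point (-1), i) \<in> G" "(point 0, 2) \<in> G" "(point 1, j) \<in> G"
  shows "activation_cone 1 2 1 points G \<subseteq> region i j"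
proof (rule activation_cone_subset[OF closedin_region])
  fix \<theta> assume \<theta>: "\<theta> \<in> space6" and "activation_pattern 1 2 1 points \<theta> = G"
  then have "\<forall>l<3. val \<theta> l (-1) \<le> val \<theta> i (-1)" "\<forall>l<3. val \<theta> l 0 \<le> val \<theta> 2 0"
    "\<forall>l<3. val \<theta> l 1 \<le> val \<theta> j 1"
    using assms by (metis activation_pattern_points_iff)+
  with \<theta> show "\<theta> \<in> region i j"
    unfolding region_def by blast
qed

lemma weakly_compatible_points:
  "weakly_compatible 2 1 points dichotomy G \<longleftrightarrow>
     (\<exists>i<2. (point (-1), i) \<in> G) \<and> (point 0, 2) \<in> G \<and> (\<exists>j<2. (point 1, j) \<in> G)"
proof -
  have plus: "{p \<in> points. dichotomy p = Plus} = {point (-1), point 1}"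
    by (auto simp: points_def dichotomy_def point_apply_0)
  have minus: "points - {point (-1), point 1} = {point 0}"
    by (auto simp: points_def)
  have summands: "{..<2} = {l. l < 2}" "{2..<2 + 1} = {2::nat}"
    by auto
  show ?thesis
    unfolding weakly_compatible_def plus minus summands neighbors_def by auto
qed

lemma perfect_cone_subset_region:
  assumes "K \<in> perfect_classification_fan 1 2 1 points dichotomy"
  obtains i j where "i < 2" "j < 2" "K \<subseteq> region i j"
proof -
  obtain G i j where K: "K = activation_cone 1 2 1 points G" and ij: "i < 2" "j < 2"
    and G: "(point (-1), i) \<in> G" "(point 0, 2) \<in> G" "(point 1, j) \<in> G"
    using assms unfolding perfect_classification_fan_def weakly_compatible_points by blast
  have "K \<subseteq> region i j"
    unfolding K by (rule activation_cone_subset_region[OF G])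
  with ij that show thesis
    by blast
qed

text \<open>By dimension, the same index cannot be maximal at both \<open>-1\<close> and \<open>1\<close>.\<close>

lemma full_dim_cone_in_region:
  assumes "K \<in> full_dim_cones 6 (perfect_classification_fan 1 2 1 points dichotomy)"
  shows "K \<subseteq> region 0 1 \<or> K \<subseteq> region 1 0"
proof -
  have K: "K \<in> perfect_classification_fan 1 2 1 points dichotomy" "dim K = 6"
    using assms by (auto simp: full_dim_cones_def)
  obtain i j where ij: "i < 2" "j < 2" "K \<subseteq> region i j"
    using K(1) by (rule perfect_cone_subset_region)
  have "i \<noteq> j"
  proof
    assume "i = j"
    then have "K \<subseteq> coincidence i 2"
      using ij region_diagonal_subset[of i] by auto
    then have "dim K \<le> 4"
      using ij(1) by (intro dim_coincidence) auto
    with K(2) show False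
      by simp
  qed
  with ij show ?thesis
    by (auto simp: less_2_cases_iff)
qed

lemma strict_maximum_unique:
  fixes f :: "nat \<Rightarrow> real"
  assumes "k < N" "\<And>l. l < N \<Longrightarrow> l \<noteq> k \<Longrightarrow> f l < f k"
  shows "(l < N \<and> (\<forall>l'<N. f l' \<le> f l)) \<longleftrightarrow> l = k"
proof
  show "l = k" if "l < N \<and> (\<forall>l'<N. f l' \<le> f l)"
    using that assms(1) assms(2)[of l] by force
  have "f l' \<le> f k" if "l' < N" for l'
    using that assms(2)[of l'] by force
  then show "l < N \<and> (\<forall>l'<N. f l' \<le> f l)" if "l = k"
    using that assms(1) by simp
qed

lemma activation_pattern_points_eq:
  assumes ij: "(i, j) = (0, 1) \<or> (i, j) = (1, 0)"
    and less: "val \<eta> j (-1) < val \<eta> i (-1)" "val \<eta> 2 (-1) < val \<eta> i (-1)"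
      "val \<eta> i 0 < val \<eta> 2 0" "val \<eta> j 0 < val \<eta> 2 0"
      "val \<eta> i 1 < val \<eta> j 1" "val \<eta> 2 1 < val \<eta> j 1"
  shows "activation_pattern 1 2 1 points \<eta> = {(point (-1), i), (point 0, 2), (point 1, j)}"
    (is "?A = ?G")
proof -
  have bound: "i < 3" "j < 3"
    using ij by auto
  have "l = i \<or> l = j \<or> l = 2" if "l < 3" for l
    using that ij by auto
  then have strict: "\<And>l. l < 3 \<Longrightarrow> l \<noteq> i \<Longrightarrow> val \<eta> l (-1) < val \<eta> i (-1)"
    "\<And>l. l < 3 \<Longrightarrow> l \<noteq> 2 \<Longrightarrow> val \<eta> l 0 < val \<eta> 2 0"
    "\<And>l. l < 3 \<Longrightarrow> l \<noteq> j \<Longrightarrow> val \<eta> l 1 < val \<eta> j 1"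
    using less by blast+
  have iff: "(point (-1), l) \<in> ?A \<longleftrightarrow> l = i" "(point 0, l) \<in> ?A \<longleftrightarrow> l = 2"
    "(point 1, l) \<in> ?A \<longleftrightarrow> l = j" for l
    unfolding activation_pattern_points_iff
    using strict_maximum_unique[OF bound(1), of "\<lambda>l. val \<eta> l (-1)" l, OF strict(1)]
      strict_maximum_unique[of 2 3 "\<lambda>l. val \<eta> l 0" l, OF _ strict(2)]
      strict_maximum_unique[OF bound(2), of "\<lambda>l. val \<eta> l 1" l, OF strict(3)]
    by (simp_all add: points_def)
  show ?thesis
  proof (intro subset_antisym subrelI)
    fix p l assume A: "(p, l) \<in> ?A"
    then have "p \<in> points"
      by (simp add: activation_pattern_def)
    then consider "p = point (-1)" | "p = point 0" | "p = point 1"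
      unfolding points_def by blast
    then show "(p, l) \<in> ?G"
      using A iff[of l] by cases simp_all
  next
    fix p l assume "(p, l) \<in> ?G"
    then consider "p = point (-1)" "l = i" | "p = point 0" "l = 2" | "p = point 1" "l = j"
      by blast
    then show "(p, l) \<in> ?A"
      using iff[of l] by cases simp_all
  qed
qed

text \<open>The parameter \<open>\<theta>\<close> below encodes \<open>v\<^sub>i = -2x\<close>, \<open>v\<^sub>j = 2x\<close> and \<open>v\<^sub>2 = 1\<close>, whose maximum at each
  of the three points exceeds the other two values by at least \<open>1\<close>.  Changing every coordinate by at
  most \<open>1/5\<close> changes each value by at most \<open>2/5\<close>, so the pattern persists.\<close>

lemma full_dim_cone_exists:
  assumes "(i, j) = (0, 1) \<or> (i, j) = (1, 0)"
  obtains K where "K \<in> full_dim_cones 6 (perfect_classification_fan 1 2 1 points dichotomy)"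
    "K \<subseteq> region i j"
proof -
  define \<theta> :: "nat \<Rightarrow> real" where
    "\<theta> = (\<lambda>k. if k = 2 * i + 1 then -2 else if k = 2 * j + 1 then 2 else if k = 4 then 1 else 0)"
  define G where "G = {(point (-1), i), (point 0, 2), (point 1, j)}"
  define K where "K = activation_cone 1 2 1 points G"
  have pattern: "activation_pattern 1 2 1 points \<eta> = G"
    if "val \<eta> j (-1) < val \<eta> i (-1)" "val \<eta> 2 (-1) < val \<eta> i (-1)"
      "val \<eta> i 0 < val \<eta> 2 0" "val \<eta> j 0 < val \<eta> 2 0"
      "val \<eta> i 1 < val \<eta> j 1" "val \<eta> 2 1 < val \<eta> j 1" for \<eta>
    unfolding G_def by (rule activation_pattern_points_eq) (use assms that in \<open>simp_all only:\<close>)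
  have in_space6: "x \<in> space6 \<longleftrightarrow> (\<forall>k\<ge>6. x k = 0)" for x
    by (simp add: param_space_def param_dim_def topspace_Euclidean_space)
  have zero: "\<theta> k = 0" if "k \<ge> 6" for k
    using that assms by (auto simp: \<theta>_def)
  have nearby: "activation_pattern 1 2 1 points \<eta> = G" if "\<And>k. \<bar>\<eta> k - \<theta> k\<bar> \<le> 1/5" for \<eta>
  proof -
    have *: "val \<theta> l x - 1/5 - 1/5 * \<bar>x\<bar> \<le> val \<eta> l x"
      "val \<eta> l x \<le> val \<theta> l x + 1/5 + 1/5 * \<bar>x\<bar>" for l x
    proof -
      have "val \<eta> l x - val \<theta> l x = (\<eta> (2 * l) - \<theta> (2 * l)) + (\<eta> (2 * l + 1) - \<theta> (2 * l + 1)) * x"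
        by (simp add: val_def algebra_simps)
      moreover have "\<bar>(\<eta> (2 * l + 1) - \<theta> (2 * l + 1)) * x\<bar> \<le> 1/5 * \<bar>x\<bar>"
        unfolding abs_mult by (intro mult_right_mono that) simp
      ultimately show "val \<theta> l x - 1/5 - 1/5 * \<bar>x\<bar> \<le> val \<eta> l x"
        "val \<eta> l x \<le> val \<theta> l x + 1/5 + 1/5 * \<bar>x\<bar>"
        using that[of "2 * l"] by linarith+
    qed
    have vals: "val \<theta> i x = - 2 * x" "val \<theta> j x = 2 * x" "val \<theta> 2 x = 1" for x
      using assms by (auto simp: \<theta>_def val_def)
    show ?thesis
      using *[of i "-1"] *[of j "-1"] *[of 2 "-1"] *[of i 0] *[of j 0] *[of 2 0]
        *[of i 1] *[of j 1] *[of 2 1]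
      unfolding vals by (intro pattern) simp_all
  qed
  have \<theta>: "\<theta> \<in> space6" "activation_pattern 1 2 1 points \<theta> = G"
    unfolding in_space6 by (simp add: zero) (rule nearby, simp)
  have perturbed: "\<theta> + (1/5) *\<^sub>R unit_vec k \<in> space6"
    "activation_pattern 1 2 1 points (\<theta> + (1/5) *\<^sub>R unit_vec k) = G" if "k < 6" for k
  proof -
    show "\<theta> + (1/5) *\<^sub>R unit_vec k \<in> space6"
      unfolding in_space6 using that by (simp add: zero scaleR_fun_apply unit_vec_def)
    show "activation_pattern 1 2 1 points (\<theta> + (1/5) *\<^sub>R unit_vec k) = G"
      by (rule nearby) (simp add: scaleR_fun_apply unit_vec_def)
  qed
  have "dim K = 6"
  proof (rule dim_eq_if_coordinate_perturbations)
    show "K \<subseteq> topspace (Euclidean_space 6)"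
      using activation_cone_subset_topspace[of 1 2 1 points G]
      by (simp add: K_def param_space_def param_dim_def)
    show "\<theta> \<in> K"
      unfolding K_def by (intro in_activation_cone \<theta>)
    show "\<theta> + (1/5) *\<^sub>R unit_vec k \<in> K" if "k < 6" for k
      unfolding K_def using that by (intro in_activation_cone perturbed)
  qed simp
  have realised: "is_activation_pattern 1 2 1 points G"
    unfolding is_activation_pattern_def using \<theta> by blast
  have G: "(point (-1), i) \<in> G" "(point 0, 2) \<in> G" "(point 1, j) \<in> G"
    by (simp_all add: G_def)
  moreover have "i < 2" "j < 2"
    using assms by auto
  ultimately have "weakly_compatible 2 1 points dichotomy G"
    unfolding weakly_compatible_points by blast
  then have "K \<in> perfect_classification_fan 1 2 1 points dichotomy"
    unfolding perfect_classification_fan_def classification_fan_def K_def using realised by blast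
  with \<open>dim K = 6\<close>
  have "K \<in> full_dim_cones 6 (perfect_classification_fan 1 2 1 points dichotomy)"
    by (simp add: full_dim_cones_def)
  moreover have "K \<subseteq> region i j"
    unfolding K_def by (rule activation_cone_subset_region[OF G])
  ultimately show thesis
    by (rule that)
qed

lemma not_strongly_connected_points:
  "\<not> strongly_connected_fan 6 (perfect_classification_fan 1 2 1 points dichotomy)"
proof
  let ?F = "full_dim_cones 6 (perfect_classification_fan 1 2 1 points dichotomy)"
  have small: "dim A \<le> 4" if "A \<subseteq> region 0 1" "A \<subseteq> region 1 0" for A
    by (rule dim_coincidence[of _ 0 1]) (use that region_Int_subset in auto)
  obtain K where K: "K \<in> ?F" "K \<subseteq> region 0 1"
    by (rule full_dim_cone_exists[of 0 1]) auto
  obtain L where L: "L \<in> ?F" "L \<subseteq> region 1 0"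
    by (rule full_dim_cone_exists[of 1 0]) auto
  assume "strongly_connected_fan 6 (perfect_classification_fan 1 2 1 points dichotomy)"
  from bspec[OF bspec[OF this[unfolded strongly_connected_fan_def] K(1)] L(1)]
  obtain r S where S: "S 0 = K" "S r = L" "\<forall>i\<le>r. S i \<in> ?F"
    "\<forall>i<r. dim (S i \<inter> S (Suc i)) + 1 = 6"
    by (elim exE conjE) (rule that)
  have "S i \<subseteq> region 0 1" if "i \<le> r" for i
    using that
  proof (induction i)
    case 0
    then show ?case
      using K S by simp
  next
    case (Suc i)
    show ?case
    proof (rule ccontr)
      assume "\<not> S (Suc i) \<subseteq> region 0 1"
      then have "S (Suc i) \<subseteq> region 1 0"
        using full_dim_cone_in_region S(3) Suc.prems by blast
      then have "dim (S i \<inter> S (Suc i)) \<le> 4"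
        using Suc by (intro small) auto
      then show False
        using S(4) Suc.prems by simp
    qed
  qed
  then have "dim L \<le> 4"
    using S(2) L(2) by (intro small) auto
  then show False
    using L(1) by (simp add: full_dim_cones_def)
qed

theorem theorem6p11:
  shows "\<exists>(d::nat) (n::nat) (m::nat) (\<D> :: (nat \<Rightarrow> real) set) (C :: (nat \<Rightarrow> real) \<Rightarrow> sign).
    d \<ge> 1 \<and> n \<ge> 1 \<and> m \<ge> 1 \<and>
    finite \<D> \<and> \<D> \<subseteq> topspace (Euclidean_space d) \<and>
    \<not> strongly_connected_fan (param_dim d n m) (perfect_classification_fan d n m \<D> C)"
proof (intro exI conjI)
  show "finite points"
    by (simp add: points_def)
  show "points \<subseteq> topspace (Euclidean_space 1)"
    by (auto simp: points_def point_def topspace_Euclidean_space)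
  show "\<not> strongly_connected_fan (param_dim 1 2 1) (perfect_classification_fan 1 2 1 points dichotomy)"
    using not_strongly_connected_points by (simp add: param_dim_def)
qed simp_all

end
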